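(* Consider the data model $y_i=\theta_{0,i}+\epsilon_i$, $i=1,\ldots,n$, with i.i.d. Gaussian errors $\epsilon_i\sim N(0,\sigma^2)$, and with $\theta_0\in\mathrm{BV}_G(t)$, where $G$ is a tree on $V=\{1,\ldots,n\}$ having maximum degree $d_{\max}$. Then there exist absolute constants $N,C>0$ such that for $n/(t\,d_{\max})>N$, $$\inf_{\hat\theta}\ \sup_{\theta_0\in\mathrm{BV}_G(t)}\ \mathbb{E}\|\hat\theta-\theta_0\|_n^2\ \ge\ C\left(\frac{t}{\sigma\,d_{\max}^2\,n}\right)^{2/3},$$ where the infimum is over all estimators $\hat\theta$ based on $y$.
   Context: For a graph $G=(V,E)$ with each edge $e$ arbitrarily oriented with endpoints $e^+,e^-$, $\|\nabla_G\theta\|_1=\sum_{e\in E}|\theta_{e^+}-\theta_{e^-}|$, and for a radius $t>0$, $\mathrm{BV}_G(t)=\{\theta\in\mathbb{R}^n:\|\nabla_G\theta\|_1\le t\}$. $\|x\|_n^2=\|x\|_2^2/n$.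
   Formalization: The constants N, C may depend on the noise level σ (not on n, t or G): with σ-independent constants the bound fails as σ → 0, since the estimator y has risk σ² while the right-hand side tends to infinity. *)

theory Defs
  imports "HOL-Probability.Probability"
begin

text \<open>Finite simple undirected graphs are given by a vertex set \<open>V\<close> and a set \<open>E\<close> of
  two-element subsets of \<open>V\<close>.\<close>

definition simple_graph :: "'v set \<Rightarrow> 'v set set \<Rightarrow> bool" where
  "simple_graph V E \<longleftrightarrow> finite V \<and> (\<forall>e\<in>E. e \<subseteq> V \<and> card e = 2)"

definition graph_connected :: "'v set \<Rightarrow> 'v set set \<Rightarrow> bool" where
  "graph_connected V E \<longleftrightarrow> V \<noteq> {} \<and> (\<forall>u\<in>V. \<forall>v\<in>V. (u, v) \<in> {(x, y). {x, y} \<in> E}\<^sup>*)"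

text \<open>A cycle is listed by its distinct vertices; the edge back from the last to the first
  vertex is the separate conjunct.\<close>

definition is_cycle :: "'v set set \<Rightarrow> 'v list \<Rightarrow> bool" where
  "is_cycle E p \<longleftrightarrow> length p \<ge> 3 \<and> distinct p \<and>
     (\<forall>i. Suc i < length p \<longrightarrow> {p ! i, p ! Suc i} \<in> E) \<and> {last p, hd p} \<in> E"

definition is_tree :: "'v set \<Rightarrow> 'v set set \<Rightarrow> bool" where
  "is_tree V E \<longleftrightarrow> simple_graph V E \<and> graph_connected V E \<and> (\<nexists>p. is_cycle E p)"

definition vertex_degree :: "'v set set \<Rightarrow> 'v \<Rightarrow> nat" where
  "vertex_degree E v = card {e \<in> E. v \<in> e}"

definition max_degree :: "'v set \<Rightarrow> 'v set set \<Rightarrow> nat" where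
  "max_degree V E = Max (vertex_degree E ` V)"

text \<open>Each edge is oriented from its smaller to its larger endpoint; the lemma
  \<open>graph_tv_any_orientation\<close> shows that the choice of orientation is immaterial.\<close>

definition graph_tv :: "'v::linorder set set \<Rightarrow> ('v \<Rightarrow> real) \<Rightarrow> real" where
  "graph_tv E \<theta> = (\<Sum>e\<in>E. \<bar>\<theta> (Max e) - \<theta> (Min e)\<bar>)"

lemma graph_tv_any_orientation:
  assumes "\<And>e. e \<in> E \<Longrightarrow> e = {head e, tail e}"
  shows "graph_tv E \<theta> = (\<Sum>e\<in>E. \<bar>\<theta> (head e) - \<theta> (tail e)\<bar>)"
  unfolding graph_tv_def
proof (rule sum.cong [OF refl])
  fix e assume "e \<in> E"
  then have e: "e = {head e, tail e}"
    by (rule assms)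
  have "Max e = max (head e) (tail e)" "Min e = min (head e) (tail e)"
    by (subst e, simp)+
  then show "\<bar>\<theta> (Max e) - \<theta> (Min e)\<bar> = \<bar>\<theta> (head e) - \<theta> (tail e)\<bar>"
    by (auto simp: max_def min_def)
qed

text \<open>Since the dimension \<open>n\<close> is quantified inside the statement, vectors of length \<open>n\<close> are
  extensional functions on \<open>{1..n}\<close>, with the product Borel sigma-algebra.\<close>

definition BV :: "'v::linorder set \<Rightarrow> 'v set set \<Rightarrow> real \<Rightarrow> ('v \<Rightarrow> real) set" where
  "BV V E t = {\<theta> \<in> V \<rightarrow>\<^sub>E UNIV. graph_tv E \<theta> \<le> t}"

definition normsq_n :: "nat \<Rightarrow> (nat \<Rightarrow> real) \<Rightarrow> real" where
  "normsq_n n x = (\<Sum>i=1..n. (x i)\<^sup>2) / real n"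

definition noise :: "nat \<Rightarrow> real \<Rightarrow> (nat \<Rightarrow> real) measure" where
  "noise n \<sigma> = PiM {1..n} (\<lambda>_. density lborel (normal_density 0 \<sigma>))"

definition estimators :: "nat \<Rightarrow> ((nat \<Rightarrow> real) \<Rightarrow> (nat \<Rightarrow> real)) set" where
  "estimators n = PiM {1..n} (\<lambda>_. borel) \<rightarrow>\<^sub>M PiM {1..n} (\<lambda>_. borel)"

text \<open>The mean squared error is a nonnegative extended real, so it is defined (possibly
  infinite) for every estimator, and infima and suprema of it are unconditional.\<close>

definition risk :: "nat \<Rightarrow> real \<Rightarrow> ((nat \<Rightarrow> real) \<Rightarrow> (nat \<Rightarrow> real)) \<Rightarrow> (nat \<Rightarrow> real) \<Rightarrow> ennreal" where
  "risk n \<sigma> est \<theta> =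
     (\<integral>\<^sup>+ \<epsilon>. ennreal (normsq_n n (\<lambda>i. est (\<lambda>j\<in>{1..n}. \<theta> j + \<epsilon> j) i - \<theta> i)) \<partial>noise n \<sigma>)"

definition minimax_risk :: "nat \<Rightarrow> real \<Rightarrow> (nat \<Rightarrow> real) set \<Rightarrow> ennreal" where
  "minimax_risk n \<sigma> \<Theta> = (INF est\<in>estimators n. SUP \<theta>\<in>\<Theta>. risk n \<sigma> est \<theta>)"

end

theory Submission
  imports Defs
begin

text \<open>Cut the tree into \<open>m\<close> blocks of at least \<open>s\<close> vertices each by deleting at most \<open>m\<close> edges;
  pruning leaf by leaf keeps each block at \<open>1 + d s\<close> vertices or fewer, so \<open>m\<close> is at least of order
  \<open>n / (d s)\<close>. On a block \<open>S\<close> put the constant signal \<open>\<plusminus>\<sigma> / sqrt |S|\<close>: every sign pattern has total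
  variation at most \<open>2 m \<sigma> / sqrt s\<close>, flipping one sign moves the Gaussian law by a bounded amount,
  and hence (Assouad) each block costs an error of order \<open>\<sigma>\<^sup>2\<close>, which gives the risk bound
  \<open>m \<sigma>\<^sup>2 / (8 n)\<close>. Since \<open>m s \<le> n\<close>, the choice \<open>s \<approx> (2 \<sigma> n / t)\<close> to the power \<open>2/3\<close> keeps the total
  variation below \<open>t\<close>.\<close>

subsection \<open>Splitting a tree into large blocks\<close>

text \<open>\<open>F\<close> is a tree on \<open>W\<close> presented as a sequence of leaf
  attachments. Induction on this presentation removes the last leaf, which is the form of argument
  that the pruning needs.\<close>

inductive grows :: "'v set \<Rightarrow> 'v set set \<Rightarrow> bool" where
  root: "grows {r} {}"
| leaf: "grows W F \<Longrightarrow> v \<notin> W \<Longrightarrow> p \<in> W \<Longrightarrow> grows (insert v W) (insert {v, p} F)"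

lemma grows_finite:
  assumes "grows W F"
  shows "finite W" "finite F" "\<Union>F \<subseteq> W"
  using assms by (induction) auto

text \<open>Needed to produce cycles: a second edge from a new vertex into the grown part closes
  such a path. A freshly attached leaf has to be linked only when it is an end of the path, so the
  path for the older vertices is extended through \<open>p\<close>.\<close>

lemma grows_path:
  assumes "grows W F" "a \<in> W" "b \<in> W"
  shows "\<exists>p. p \<noteq> [] \<and> hd p = a \<and> last p = b \<and> distinct p \<and> set p \<subseteq> W \<and>
    successively (\<lambda>x y. {x, y} \<in> F) p"
  using assms
proof (induction arbitrary: a b)
  case (root r)
  then show ?case by (intro exI[of _ "[r]"]) auto
next
  case (leaf W F v p)
  have mono: "successively (\<lambda>x y. {x, y} \<in> insert {v, p} F) q"
    if "successively (\<lambda>x y. {x, y} \<in> F) q" for q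
    using that by (rule successively_mono) auto
  consider "a = v" "b = v" | "a = v" "b \<in> W" | "a \<in> W" "b = v" | "a \<in> W" "b \<in> W"
    using leaf.prems by auto
  then show ?case
  proof cases
    case 1
    then show ?thesis by (intro exI[of _ "[v]"]) auto
  next
    case 2
    with leaf.IH[of p b] leaf.hyps obtain q where
      "q \<noteq> []" "hd q = p" "last q = b" "distinct q" "set q \<subseteq> W"
      "successively (\<lambda>x y. {x, y} \<in> F) q" by blast
    with 2 leaf.hyps mono[of q] show ?thesis
      by (intro exI[of _ "v # q"]) (auto simp: successively_Cons)
  next
    case 3
    with leaf.IH[of a p] leaf.hyps obtain q where
      "q \<noteq> []" "hd q = a" "last q = p" "distinct q" "set q \<subseteq> W"
      "successively (\<lambda>x y. {x, y} \<in> F) q" by blast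
    with 3 leaf.hyps mono[of q] show ?thesis
      by (intro exI[of _ "q @ [v]"]) (auto simp: successively_append_iff insert_commute)
  next
    case 4
    with leaf.IH[of a b] mono show ?thesis by blast
  qed
qed

lemma rtrancl_leaves_set:
  assumes "(a, b) \<in> R\<^sup>*" "a \<in> W" "b \<notin> W"
  shows "\<exists>u v. u \<in> W \<and> v \<notin> W \<and> (u, v) \<in> R"
  using assms by (induction rule: rtrancl_induct) auto

text \<open>Take a largest vertex set whose induced edges can be grown. If it is not
  \<open>V\<close>, connectedness provides an edge to some outside vertex \<open>v\<close>, and
  acyclicity makes it the only edge from \<open>v\<close> back into the set, so \<open>v\<close> is
  a further leaf.\<close>

lemma tree_grows:
  assumes "is_tree V E"
  shows "grows V E"
proof -
  have fin: "finite V" and E: "\<And>e. e \<in> E \<Longrightarrow> e \<subseteq> V \<and> card e = 2"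
    and ne: "V \<noteq> {}"
    and conn: "\<And>u v. u \<in> V \<Longrightarrow> v \<in> V \<Longrightarrow> (u, v) \<in> {(x, y). {x, y} \<in> E}\<^sup>*"
    and acyc: "\<And>p. \<not> is_cycle E p"
    using assms by (auto simp: is_tree_def simple_graph_def graph_connected_def)
  \<comment> \<open>All induced edges are required, so that reaching \<open>W = V\<close> gives the
    whole edge set \<open>E\<close>.\<close>
  define ok where "ok W \<longleftrightarrow> W \<subseteq> V \<and> grows W {e \<in> E. e \<subseteq> W}" for W
  obtain r where r: "r \<in> V" using ne by auto
  have "{e \<in> E. e \<subseteq> {r}} = {}"
    using E by (force simp: subset_singleton_iff)
  then have "ok {r}"
    using grows.root[of r] r unfolding ok_def by (metis empty_subsetI insert_subset)
  moreover have "card W \<le> card V" if "ok W" for W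
    using that fin by (auto simp: ok_def intro: card_mono)
  ultimately obtain W where W: "ok W" and max: "\<And>W'. ok W' \<Longrightarrow> card W' \<le> card W"
    using ex_has_greatest_nat[of ok "{r}" card "Suc (card V)"] by (meson le_imp_less_Suc)
  have WV: "W \<subseteq> V" and gW: "grows W {e \<in> E. e \<subseteq> W}"
    using W by (auto simp: ok_def)
  have "W \<noteq> {}" using gW by cases auto
  have "W = V"
  proof (rule ccontr)
    assume "W \<noteq> V"
    with WV \<open>W \<noteq> {}\<close> obtain a b where ab: "a \<in> W" "b \<in> V" "b \<notin> W" by auto
    then have "(a, b) \<in> {(x, y). {x, y} \<in> E}\<^sup>*" using WV by (intro conn) auto
    from rtrancl_leaves_set[OF this ab(1,3)] obtain u v where
      uv: "u \<in> W" "v \<notin> W" "{u, v} \<in> E" by auto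
    have "v \<in> V" using E[OF uv(3)] by auto
    have unique: "e = {v, u}" if e: "e \<in> E" "e \<subseteq> insert v W" "\<not> e \<subseteq> W" for e
    proof (rule ccontr)
      assume "e \<noteq> {v, u}"
      have "v \<in> e" using e by auto
      with E[OF e(1)] obtain b where b: "e = {v, b}" "b \<noteq> v"
        by (auto simp: card_2_iff)
      with e \<open>e \<noteq> {v, u}\<close> have "b \<in> W" "b \<noteq> u" by auto
      with grows_path[OF gW uv(1)] obtain p where
        p: "p \<noteq> []" "hd p = u" "last p = b" "distinct p" "set p \<subseteq> W"
        "successively (\<lambda>x y. {x, y} \<in> {e \<in> E. e \<subseteq> W}) p" by blast
      \<comment> \<open>Since \<open>b\<close> differs from \<open>u\<close>, the path has two
        vertices at least, and adding \<open>v\<close> gives the three that a cycle must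
        have.\<close>
      have "length p \<ge> 2"
        using p(1-3) \<open>b \<noteq> u\<close> by (cases p rule: list.exhaust; cases "tl p") auto
      have "successively (\<lambda>x y. {x, y} \<in> E) p"
        using p(6) by (rule successively_mono) auto
      then have "successively (\<lambda>x y. {x, y} \<in> E) (p @ [v])"
        using p b e by (auto simp: successively_append_iff insert_commute)
      then have "is_cycle E (p @ [v])"
        using p uv \<open>length p \<ge> 2\<close>
        by (auto simp: is_cycle_def successively_conv_nth insert_commute)
      then show False using acyc by blast
    qed
    have "{v, u} \<in> E" using uv(3) by (simp add: insert_commute)
    have "{e \<in> E. e \<subseteq> insert v W} = insert {v, u} {e \<in> E. e \<subseteq> W}"
    proof
      show "{e \<in> E. e \<subseteq> insert v W} \<subseteq> insert {v, u} {e \<in> E. e \<subseteq> W}"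
        using unique by blast
      show "insert {v, u} {e \<in> E. e \<subseteq> W} \<subseteq> {e \<in> E. e \<subseteq> insert v W}"
        using \<open>{v, u} \<in> E\<close> uv(1) by auto
    qed
    then have "ok (insert v W)"
      using grows.leaf[OF gW uv(2,1)] WV \<open>v \<in> V\<close> by (simp add: ok_def)
    from max[OF this] uv(2) finite_subset[OF WV fin] show False by simp
  qed
  moreover have "{e \<in> E. e \<subseteq> V} = E" using E by auto
  ultimately show ?thesis using gW by simp
qed

text \<open>A leaf lighter than \<open>s\<close> hands its weight to its neighbour, a heavier one becomes the top of a
  new block; the weights and the degree hypothesis are what survives this pruning. Vertices whose
  label lies outside \<open>J\<close> form the leftover.\<close>

lemma grows_partition:
  fixes w :: "'v \<Rightarrow> nat"
  assumes "grows W F" "\<And>x. x \<in> W \<Longrightarrow> w x + vertex_degree F x * s \<le> B"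
  shows "\<exists>(c :: 'v \<Rightarrow> nat) J. finite J \<and>
    (\<forall>j\<in>J. s \<le> (\<Sum>x\<in>W. if c x = j then w x else 0)) \<and>
    (\<Sum>x\<in>W. w x) \<le> card J * B + s \<and>
    card {e \<in> F. \<not> (\<exists>k. \<forall>x\<in>e. c x = k)} \<le> card J"
  using assms
proof (induction arbitrary: w)
  case (root r)
  then have B: "w r \<le> B" by fastforce
  show ?case
  proof (cases "s \<le> w r")
    case True
    with B show ?thesis
      by (intro exI[of _ "\<lambda>_. 0"] exI[of _ "{0}"]) auto
  next
    \<comment> \<open>The last remaining vertex can be too light for a block; it then stays as
      leftover, which is where the \<open>+ s\<close> in the total comes from.\<close>
    case False
    then show ?thesis
      by (intro exI[of _ "\<lambda>_. 0"] exI[of _ "{}"]) auto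
  qed
next
  case (leaf W F v p)
  note fin = grows_finite[OF leaf.hyps(1)]
  have new: "{v, p} \<notin> F" using fin(3) leaf.hyps(2) by auto
  have vp: "v \<noteq> p" using leaf.hyps by auto
  have deg: "vertex_degree F x + (if x = p then 1 else 0) \<le> vertex_degree (insert {v, p} F) x"
    for x
  proof (cases "x = p")
    case True
    have "{e \<in> insert {v, p} F. p \<in> e} = insert {v, p} {e \<in> F. p \<in> e}" by auto
    with True new fin(2) show ?thesis by (simp add: vertex_degree_def)
  next
    case False
    with fin(2) show ?thesis by (auto simp: vertex_degree_def intro!: card_mono)
  qed
  \<comment> \<open>Removing the leaf frees a budget of \<open>s\<close> at \<open>p\<close>. This
    pays for the weight, less than \<open>s\<close>, that a light leaf hands over.\<close>
  have deg_s: "vertex_degree F x * s + (if x = p then s else 0)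
      \<le> vertex_degree (insert {v, p} F) x * s" for x
    using mult_le_mono1[OF deg[of x], of s] by (auto simp: algebra_simps split: if_splits)
  show ?case
  proof (cases "s \<le> w v")
    case True
    have "w x + vertex_degree F x * s \<le> B" if "x \<in> W" for x
      using leaf.prems[of x] that deg_s[of x] by auto
    from leaf.IH[OF this] obtain c :: "'v \<Rightarrow> nat" and J where
      fJ: "finite J" and J: "\<forall>j\<in>J. s \<le> (\<Sum>x\<in>W. if c x = j then w x else 0)"
      and tot: "(\<Sum>x\<in>W. w x) \<le> card J * B + s"
      and cut: "card {e \<in> F. \<not> (\<exists>k. \<forall>x\<in>e. c x = k)} \<le> card J" by blast
    \<comment> \<open>A heavy leaf opens a block with the fresh label \<open>k\<close>. Its weight
      is at most \<open>B\<close>, and \<open>{v, p}\<close> is the only edge that can be newly cut,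
      so both bounds grow in step with \<open>card J\<close>.\<close>
    obtain k where k: "k \<notin> J \<union> c ` W"
      using ex_new_if_finite[of "J \<union> c ` W"] fJ fin(1) by auto
    let ?c = "c(v := k)"
    have eqW: "(\<Sum>x\<in>W. if ?c x = j then w x else 0) = (\<Sum>x\<in>W. if c x = j then w x else 0)" for j
      using leaf.hyps(2) by (intro sum.cong) auto
    have "\<forall>j\<in>insert k J. s \<le> (\<Sum>x\<in>insert v W. if ?c x = j then w x else 0)"
      using True J leaf.hyps(2) fin(1) by (auto simp: eqW simp del: fun_upd_apply) (auto intro: trans_le_add1)
    moreover have "(\<Sum>x\<in>insert v W. w x) \<le> card (insert k J) * B + s"
      using tot leaf.prems[of v] k fJ leaf.hyps(2) fin(1) by auto
    moreover have "card {e \<in> insert {v, p} F. \<not> (\<exists>k. \<forall>x\<in>e. ?c x = k)} \<le> card (insert k J)"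
    proof -
      have "(\<exists>k. \<forall>x\<in>e. ?c x = k) \<longleftrightarrow> (\<exists>k. \<forall>x\<in>e. c x = k)" if "e \<in> F" for e
        using that fin(3) leaf.hyps(2) by (intro ex_cong1 ball_cong) auto
      then have "{e \<in> insert {v, p} F. \<not> (\<exists>k. \<forall>x\<in>e. ?c x = k)}
          \<subseteq> insert {v, p} {e \<in> F. \<not> (\<exists>k. \<forall>x\<in>e. c x = k)}" by blast
      then have "card {e \<in> insert {v, p} F. \<not> (\<exists>k. \<forall>x\<in>e. ?c x = k)}
          \<le> card (insert {v, p} {e \<in> F. \<not> (\<exists>k. \<forall>x\<in>e. c x = k)})"
        using fin(2) by (intro card_mono) auto
      also have "\<dots> \<le> Suc (card {e \<in> F. \<not> (\<exists>k. \<forall>x\<in>e. c x = k)})"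
        by (rule card_insert_le_m1[of "Suc _", simplified]) simp
      finally show ?thesis using cut k fJ by simp
    qed
    ultimately show ?thesis using fJ
      by (intro exI[of _ ?c] exI[of _ "insert k J"]) auto
  next
    case False
    \<comment> \<open>A light leaf takes the label of \<open>p\<close>. Its weight is already
      counted at \<open>p\<close>, so the block weights stay the same and no edge is newly
      cut.\<close>
    let ?w = "w(p := w p + w v)"
    have "?w x + vertex_degree F x * s \<le> B" if "x \<in> W" for x
      using leaf.prems[of x] that order_trans[OF add_left_mono[OF deg_s[of x]], of "w x" B] False by auto
    from leaf.IH[OF this] obtain c :: "'v \<Rightarrow> nat" and J where
      fJ: "finite J" and J: "\<forall>j\<in>J. s \<le> (\<Sum>x\<in>W. if c x = j then ?w x else 0)"
      and tot: "(\<Sum>x\<in>W. ?w x) \<le> card J * B + s"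
      and cut: "card {e \<in> F. \<not> (\<exists>k. \<forall>x\<in>e. c x = k)} \<le> card J" by blast
    let ?c = "c(v := c p)"
    have merge: "(\<Sum>x\<in>insert v W. if ?c x = j then w x else 0)
        = (\<Sum>x\<in>W. if c x = j then ?w x else 0)" for j
    proof -
      have "(\<Sum>x\<in>W - {p}. if ?c x = j then w x else 0) = (\<Sum>x\<in>W - {p}. if c x = j then ?w x else 0)"
        using leaf.hyps(2) by (intro sum.cong) auto
      then show ?thesis
        using leaf.hyps vp fin(1) by (simp add: sum.remove[of W p])
    qed
    have "(\<Sum>x\<in>insert v W. w x) = (\<Sum>x\<in>W. ?w x)"
      using leaf.hyps vp fin(1) by (simp add: sum.remove[of W p])
    moreover have "card {e \<in> insert {v, p} F. \<not> (\<exists>k. \<forall>x\<in>e. ?c x = k)} \<le> card J"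
    proof -
      have "(\<exists>k. \<forall>x\<in>e. ?c x = k) \<longleftrightarrow> (\<exists>k. \<forall>x\<in>e. c x = k)" if "e \<in> F" for e
        using that fin(3) leaf.hyps(2) by (intro ex_cong1 ball_cong) auto
      moreover have "\<exists>k. \<forall>x\<in>{v, p}. ?c x = k" by auto
      ultimately have "{e \<in> insert {v, p} F. \<not> (\<exists>k. \<forall>x\<in>e. ?c x = k)}
          \<subseteq> {e \<in> F. \<not> (\<exists>k. \<forall>x\<in>e. c x = k)}" by blast
      from card_mono[OF _ this] fin(2) cut show ?thesis by simp
    qed
    ultimately show ?thesis using fJ J tot merge
      by (intro exI[of _ ?c] exI[of _ J]) presburger
  qed
qed

lemma vertex_degree_le_max_degree:
  "finite V \<Longrightarrow> v \<in> V \<Longrightarrow> vertex_degree E v \<le> max_degree V E"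
  unfolding max_degree_def by (intro Max_ge) auto

text \<open>With unit weights the block weights are cardinalities. The budget is
  \<open>1 + d * s\<close> because a vertex starts with weight 1 and receives less than
  \<open>s\<close> along each of its at most \<open>d\<close> edges.\<close>

lemma tree_partition:
  assumes tree: "is_tree V E" and s: "s \<ge> 1"
  shows "\<exists>(c :: 'v \<Rightarrow> nat) J. finite J \<and> (\<forall>j\<in>J. s \<le> card {x\<in>V. c x = j}) \<and>
    card V \<le> card J * (1 + max_degree V E * s) + s \<and>
    card {e \<in> E. \<not> (\<exists>k. \<forall>x\<in>e. c x = k)} \<le> card J"
proof -
  have fin: "finite V" using tree by (simp add: is_tree_def simple_graph_def)
  have "1 + vertex_degree E x * s \<le> 1 + max_degree V E * s" if "x \<in> V" for x
    using vertex_degree_le_max_degree[OF fin that, of E] by simp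
  from grows_partition[OF tree_grows[OF tree], of "\<lambda>_. 1", OF this]
  obtain c :: "'v \<Rightarrow> nat" and J where
    J: "finite J" "\<forall>j\<in>J. s \<le> (\<Sum>x\<in>V. if c x = j then 1 else 0)"
    and "(\<Sum>x\<in>V. 1) \<le> card J * (1 + max_degree V E * s) + s"
      "card {e \<in> E. \<not> (\<exists>k. \<forall>x\<in>e. c x = k)} \<le> card J" by blast
  moreover have "(\<Sum>x\<in>V. if c x = j then 1 else 0) = card {x\<in>V. c x = j}" for j
    using fin by (simp add: sum.If_cases Int_def)
  ultimately show ?thesis by (intro exI[of _ c] exI[of _ J]) simp
qed

lemma card_mult_le_of_blocks:
  assumes "finite V" "finite J" "\<And>j. j \<in> J \<Longrightarrow> s \<le> card {x\<in>V. c x = j}"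
  shows "card J * s \<le> card V"
proof -
  have "card J * s \<le> (\<Sum>j\<in>J. card {x\<in>V. c x = j})"
    using sum_mono[of J "\<lambda>_. s", OF assms(3)] by simp
  also have "\<dots> = card (\<Union>j\<in>J. {x\<in>V. c x = j})"
    using assms(1,2) by (intro card_UN_disjoint[symmetric]) auto
  also have "\<dots> \<le> card V"
    using assms(1) by (intro card_mono) auto
  finally show ?thesis .
qed

subsection \<open>Gaussian product measures\<close>

definition gauss :: "'i set \<Rightarrow> real \<Rightarrow> ('i \<Rightarrow> real) \<Rightarrow> ('i \<Rightarrow> real) measure" where
  "gauss I \<sigma> \<theta> = PiM I (\<lambda>i. density lborel (normal_density (\<theta> i) \<sigma>))"

definition gdens :: "'i set \<Rightarrow> real \<Rightarrow> ('i \<Rightarrow> real) \<Rightarrow> ('i \<Rightarrow> real) \<Rightarrow> real" where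
  "gdens I \<sigma> \<theta> y = (\<Prod>i\<in>I. normal_density (\<theta> i) \<sigma> (y i))"

lemma gdens_nonneg: "0 \<le> gdens I \<sigma> \<theta> y"
  by (simp add: gdens_def prod_nonneg normal_density_nonneg)

lemma gdens_measurable [measurable]: "finite I \<Longrightarrow> gdens I \<sigma> \<theta> \<in> borel_measurable (PiM I (\<lambda>_. lborel))"
  unfolding gdens_def[abs_def] by measurable

lemma distr_normal_shift:
  assumes "\<sigma> > 0"
  shows "distr (density lborel (normal_density 0 \<sigma>)) borel ((+) a)
    = density lborel (normal_density a \<sigma>)"
proof -
  interpret N: prob_space "density lborel (normal_density 0 \<sigma>)"
    using assms by (rule prob_space_normal_density)
  have "distributed (density lborel (normal_density 0 \<sigma>)) lborel (\<lambda>x. x) (normal_density 0 \<sigma>)"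
    by (simp add: distributed_def distr_id2)
  from N.normal_density_affine[OF this assms, of 1 a]
  have "distributed (density lborel (normal_density 0 \<sigma>)) lborel (\<lambda>x. a + x) (normal_density a \<sigma>)"
    using assms by simp
  then have "density lborel (normal_density a \<sigma>)
      = distr (density lborel (normal_density 0 \<sigma>)) lborel ((+) a)"
    by (simp add: distributed_distr_eq_density)
  then show ?thesis
    by (simp cong: distr_cong)
qed

text \<open>Identifies the law of signal plus noise, as it occurs in \<open>risk\<close>, with a
  product of shifted normals. A product measure is determined by its values on boxes, and a
  coordinatewise shift pulls boxes back to boxes.\<close>

lemma gauss_eq_distr:
  assumes "\<sigma> > 0"
  shows "gauss {1..n} \<sigma> \<theta> = distr (noise n \<sigma>) (PiM {1..n} (\<lambda>_. borel)) (\<lambda>\<epsilon>. \<lambda>j\<in>{1..n}. \<theta> j + \<epsilon> j)"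
proof -
  interpret N: product_prob_space "\<lambda>i. density lborel (normal_density (\<theta> i) \<sigma>)"
    using assms by (intro product_prob_spaceI prob_space_normal_density)
  interpret N0: product_prob_space "\<lambda>i::nat. density lborel (normal_density 0 \<sigma>)"
    using assms by (intro product_prob_spaceI prob_space_normal_density)
  let ?B = "PiM {1..n} (\<lambda>_. borel) :: (nat \<Rightarrow> real) measure"
  have sets_noise [measurable_cong]: "sets (noise n \<sigma>) = sets ?B"
    unfolding noise_def by (intro sets_PiM_cong) auto
  have "distr (noise n \<sigma>) ?B (\<lambda>\<epsilon>. \<lambda>j\<in>{1..n}. \<theta> j + \<epsilon> j)
      = PiM {1..n} (\<lambda>i. density lborel (normal_density (\<theta> i) \<sigma>))"
  proof (rule N.PiM_eqI)
    show "sets (distr (noise n \<sigma>) ?B (\<lambda>\<epsilon>. \<lambda>j\<in>{1..n}. \<theta> j + \<epsilon> j))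
        = sets (PiM {1..n} (\<lambda>i. density lborel (normal_density (\<theta> i) \<sigma>)))"
      by (simp, intro sets_PiM_cong) auto
    fix A :: "nat \<Rightarrow> real set"
    assume A: "\<And>i. i \<in> {1..n} \<Longrightarrow> A i \<in> sets (density lborel (normal_density (\<theta> i) \<sigma>))"
    have meas: "(\<lambda>\<epsilon>. \<lambda>j\<in>{1..n}. \<theta> j + \<epsilon> j) \<in> noise n \<sigma> \<rightarrow>\<^sub>M ?B"
      by measurable
    have "emeasure (distr (noise n \<sigma>) ?B (\<lambda>\<epsilon>. \<lambda>j\<in>{1..n}. \<theta> j + \<epsilon> j)) (Pi\<^sub>E {1..n} A)
        = emeasure (noise n \<sigma>) ((\<lambda>\<epsilon>. \<lambda>j\<in>{1..n}. \<theta> j + \<epsilon> j) -` Pi\<^sub>E {1..n} A \<inter> space (noise n \<sigma>))"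
      using A meas by (intro emeasure_distr sets_PiM_I_finite) auto
    also have "(\<lambda>\<epsilon>. \<lambda>j\<in>{1..n}. \<theta> j + \<epsilon> j) -` Pi\<^sub>E {1..n} A \<inter> space (noise n \<sigma>)
        = Pi\<^sub>E {1..n} (\<lambda>i. (+) (\<theta> i) -` A i)"
      by (auto simp: noise_def space_PiM PiE_def Pi_def extensional_def)
    also have "emeasure (noise n \<sigma>) \<dots>
        = (\<Prod>i=1..n. emeasure (density lborel (normal_density 0 \<sigma>)) ((+) (\<theta> i) -` A i))"
      unfolding noise_def
    proof (intro N0.emeasure_PiM)
      fix i assume "i \<in> {1..n}"
      with A[of i] have "A i \<in> sets borel" by simp
      then show "(+) (\<theta> i) -` A i \<in> sets (density lborel (normal_density 0 \<sigma>))"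
        using measurable_sets[of "(+) (\<theta> i)" borel borel "A i"] by simp
    qed simp
    also have "\<dots> = (\<Prod>i=1..n. emeasure (density lborel (normal_density (\<theta> i) \<sigma>)) (A i))"
    proof (intro prod.cong refl)
      fix i assume "i \<in> {1..n}"
      with A[of i] have "A i \<in> sets borel" by simp
      then show "emeasure (density lborel (normal_density 0 \<sigma>)) ((+) (\<theta> i) -` A i)
          = emeasure (density lborel (normal_density (\<theta> i) \<sigma>)) (A i)"
        by (subst distr_normal_shift[OF assms, of "\<theta> i", symmetric]) (simp add: emeasure_distr)
    qed
    finally show "emeasure (distr (noise n \<sigma>) ?B (\<lambda>\<epsilon>. \<lambda>j\<in>{1..n}. \<theta> j + \<epsilon> j)) (Pi\<^sub>E {1..n} A)
        = (\<Prod>i=1..n. emeasure (density lborel (normal_density (\<theta> i) \<sigma>)) (A i))" .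
  qed simp
  then show ?thesis by (simp add: gauss_def)
qed

text \<open>Again both measures are compared on boxes, where the integral of the product density
  factorises.\<close>

lemma gauss_eq_density:
  assumes "\<sigma> > 0" and [simp]: "finite I"
  shows "gauss I \<sigma> \<theta> = density (PiM I (\<lambda>_. lborel)) (gdens I \<sigma> \<theta>)"
proof -
  interpret N: product_prob_space "\<lambda>i. density lborel (normal_density (\<theta> i) \<sigma>)"
    using assms by (intro product_prob_spaceI prob_space_normal_density)
  interpret L: product_sigma_finite "\<lambda>_. lborel :: real measure"
    by standard
  let ?D = "density (PiM I (\<lambda>_. lborel)) (gdens I \<sigma> \<theta>)"
  have "?D = PiM I (\<lambda>i. density lborel (normal_density (\<theta> i) \<sigma>))"
  proof (rule N.PiM_eqI)
    show "sets ?D = sets (PiM I (\<lambda>i. density lborel (normal_density (\<theta> i) \<sigma>)))"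
      by (simp, intro sets_PiM_cong) auto
    fix A
    assume "\<And>i. i \<in> I \<Longrightarrow> A i \<in> sets (density lborel (normal_density (\<theta> i) \<sigma>))"
    then have A [measurable]: "\<And>i. i \<in> I \<Longrightarrow> A i \<in> sets borel" by simp
    have "emeasure ?D (Pi\<^sub>E I A)
        = (\<integral>\<^sup>+y. ennreal (gdens I \<sigma> \<theta> y) * indicator (Pi\<^sub>E I A) y \<partial>PiM I (\<lambda>_. lborel))"
      using A by (intro emeasure_density sets_PiM_I_finite) auto
    also have "\<dots> = (\<integral>\<^sup>+y. (\<Prod>i\<in>I. ennreal (normal_density (\<theta> i) \<sigma> (y i)) * indicator (A i) (y i))
        \<partial>PiM I (\<lambda>_. lborel))"
    proof (intro nn_integral_cong)
      fix y :: "'a \<Rightarrow> real" assume "y \<in> space (PiM I (\<lambda>_. lborel))"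
      \<comment> \<open>Points of the product space are extensional, so lying in the box is a
        condition on the coordinates in \<open>I\<close> alone.\<close>
      then have "indicator (Pi\<^sub>E I A) y = (\<Prod>i\<in>I. indicator (A i) (y i) :: ennreal)"
        by (auto simp: space_PiM PiE_iff indicator_def prod_zero_iff)
      then show "ennreal (gdens I \<sigma> \<theta> y) * indicator (Pi\<^sub>E I A) y
          = (\<Prod>i\<in>I. ennreal (normal_density (\<theta> i) \<sigma> (y i)) * indicator (A i) (y i))"
        by (simp add: gdens_def prod.distrib prod_ennreal normal_density_nonneg)
    qed
    also have "\<dots> = (\<Prod>i\<in>I. \<integral>\<^sup>+x. ennreal (normal_density (\<theta> i) \<sigma> x) * indicator (A i) x \<partial>lborel)"
      by (intro L.product_nn_integral_prod) auto
    also have "\<dots> = (\<Prod>i\<in>I. emeasure (density lborel (normal_density (\<theta> i) \<sigma>)) (A i))"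
      by (intro prod.cong refl emeasure_density[symmetric]) auto
    finally show "emeasure ?D (Pi\<^sub>E I A)
        = (\<Prod>i\<in>I. emeasure (density lborel (normal_density (\<theta> i) \<sigma>)) (A i))" .
  qed fact
  then show ?thesis by (simp add: gauss_def)
qed

lemma nn_integral_gdens:
  assumes "\<sigma> > 0" and [simp]: "finite I"
  shows "(\<integral>\<^sup>+y. ennreal (gdens I \<sigma> \<theta> y) \<partial>PiM I (\<lambda>_. lborel)) = 1"
proof -
  interpret prob_space "gauss I \<sigma> \<theta>"
    unfolding gauss_def using assms by (intro prob_space_PiM prob_space_normal_density)
  have "emeasure (gauss I \<sigma> \<theta>) (space (gauss I \<sigma> \<theta>)) = 1" by (rule emeasure_space_1)
  then show ?thesis
    by (simp add: gauss_eq_density[OF assms] emeasure_density space_density cong: nn_integral_cong)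
qed

text \<open>Puts the risks at all signals over one common base measure, so that two signals can be
  compared pointwise in \<open>y\<close>.\<close>

lemma risk_eq_gdens:
  assumes "\<sigma> > 0" "est \<in> estimators n"
  shows "risk n \<sigma> est \<theta> =
    (\<integral>\<^sup>+y. ennreal (normsq_n n (\<lambda>i. est y i - \<theta> i) * gdens {1..n} \<sigma> \<theta> y) \<partial>PiM {1..n} (\<lambda>_. lborel))"
proof -
  let ?B = "PiM {1..n} (\<lambda>_. borel) :: (nat \<Rightarrow> real) measure"
  have [measurable]: "est \<in> ?B \<rightarrow>\<^sub>M ?B" using assms(2) by (simp add: estimators_def)
  have [measurable_cong]: "sets (noise n \<sigma>) = sets ?B"
    unfolding noise_def by (intro sets_PiM_cong) auto
  have [measurable_cong]: "sets (PiM {1..n} (\<lambda>_. lborel)) = sets ?B"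
    by (intro sets_PiM_cong) auto
  have nonneg: "0 \<le> normsq_n n x" for x
    by (simp add: normsq_n_def sum_nonneg)
  have [measurable]: "(\<lambda>y. ennreal (normsq_n n (\<lambda>i. est y i - \<theta> i))) \<in> borel_measurable ?B"
    unfolding normsq_n_def by measurable
  have "risk n \<sigma> est \<theta> = (\<integral>\<^sup>+y. ennreal (normsq_n n (\<lambda>i. est y i - \<theta> i)) \<partial>gauss {1..n} \<sigma> \<theta>)"
    unfolding risk_def gauss_eq_distr[OF assms(1)] by (subst nn_integral_distr) measurable
  also have "\<dots> = (\<integral>\<^sup>+y. ennreal (gdens {1..n} \<sigma> \<theta> y) * ennreal (normsq_n n (\<lambda>i. est y i - \<theta> i))
      \<partial>PiM {1..n} (\<lambda>_. lborel))"
    unfolding gauss_eq_density[OF assms(1) finite_atLeastAtMost] by (intro nn_integral_density) measurable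
  finally show ?thesis
    by (simp add: ennreal_mult[symmetric] nonneg gdens_nonneg mult.commute)
qed

subsection \<open>The two-point bound\<close>

text \<open>The squares \<open>(x - a)\<^sup>2\<close> and \<open>(x + a)\<^sup>2\<close> add up to
  twice \<open>x\<^sup>2 + a\<^sup>2\<close>, so the geometric mean of the two densities is a scaled
  centred density. The scaling factor is their Hellinger affinity.\<close>

lemma sqrt_normal_density_mult:
  assumes "\<sigma> > 0"
  shows "sqrt (normal_density a \<sigma> x * normal_density (-a) \<sigma> x)
    = exp (- (a\<^sup>2 / (2 * \<sigma>\<^sup>2))) * normal_density 0 \<sigma> x"
proof -
  have "exp (- (x - a)\<^sup>2 / (2 * \<sigma>\<^sup>2)) * exp (- (x + a)\<^sup>2 / (2 * \<sigma>\<^sup>2))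
      = (exp (- (a\<^sup>2 / (2 * \<sigma>\<^sup>2))) * exp (- x\<^sup>2 / (2 * \<sigma>\<^sup>2)))\<^sup>2"
    unfolding mult_exp_exp exp_double[symmetric]
    by (rule arg_cong[where f = exp]) (simp add: divide_simps power2_eq_square algebra_simps)
  then have "normal_density a \<sigma> x * normal_density (-a) \<sigma> x
      = (exp (- (a\<^sup>2 / (2 * \<sigma>\<^sup>2))) * normal_density 0 \<sigma> x)\<^sup>2"
    by (simp add: normal_density_def power_mult_distrib power_divide mult.assoc mult.left_commute)
  then show ?thesis
    by (simp add: real_sqrt_abs abs_mult normal_density_nonneg)
qed

lemma sqrt_prod: "sqrt (\<Prod>i\<in>I. f i) = (\<Prod>i\<in>I. sqrt (f i))"
  by (induction I rule: infinite_finite_induct) (auto simp: real_sqrt_mult)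

text \<open>The geometric mean is taken coordinate by coordinate. Where the means agree it returns
  the density itself, and each flipped coordinate contributes its affinity factor, so the constant
  depends only on the energy of the signal on \<open>S\<close>.\<close>

lemma sqrt_gdens_mult:
  assumes "\<sigma> > 0" "finite I" "S \<subseteq> I"
    and same: "\<And>i. i \<in> I - S \<Longrightarrow> \<theta>' i = \<theta> i"
    and flip: "\<And>i. i \<in> S \<Longrightarrow> \<theta>' i = - \<theta> i"
  shows "sqrt (gdens I \<sigma> \<theta> y * gdens I \<sigma> \<theta>' y)
    = exp (- ((\<Sum>i\<in>S. (\<theta> i)\<^sup>2) / (2 * \<sigma>\<^sup>2))) * gdens I \<sigma> (\<lambda>i. if i \<in> S then 0 else \<theta> i) y"
proof -
  have "sqrt (gdens I \<sigma> \<theta> y * gdens I \<sigma> \<theta>' y)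
      = (\<Prod>i\<in>I. sqrt (normal_density (\<theta> i) \<sigma> (y i) * normal_density (\<theta>' i) \<sigma> (y i)))"
    by (simp add: gdens_def prod.distrib[symmetric] sqrt_prod)
  also have "\<dots> = (\<Prod>i\<in>I. (if i \<in> S then exp (- ((\<theta> i)\<^sup>2 / (2 * \<sigma>\<^sup>2))) else 1)
      * normal_density (if i \<in> S then 0 else \<theta> i) \<sigma> (y i))"
  proof (intro prod.cong refl)
    fix i assume "i \<in> I"
    then show "sqrt (normal_density (\<theta> i) \<sigma> (y i) * normal_density (\<theta>' i) \<sigma> (y i))
      = (if i \<in> S then exp (- ((\<theta> i)\<^sup>2 / (2 * \<sigma>\<^sup>2))) else 1)
      * normal_density (if i \<in> S then 0 else \<theta> i) \<sigma> (y i)"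
      using same flip sqrt_normal_density_mult[OF assms(1)] normal_density_nonneg
      by (cases "i \<in> S") (auto simp: real_sqrt_mult_self)
  qed
  also have "\<dots> = (\<Prod>i\<in>S. exp (- ((\<theta> i)\<^sup>2 / (2 * \<sigma>\<^sup>2))))
      * gdens I \<sigma> (\<lambda>i. if i \<in> S then 0 else \<theta> i) y"
    using assms(2,3)
    by (simp add: prod.distrib gdens_def prod.If_cases Int_absorb1)
  finally show ?thesis
    using finite_subset[OF assms(3,2)]
    by (simp add: exp_sum[symmetric] sum_negf sum_divide_distrib)
qed

text \<open>Bounds the overlap \<open>min p q\<close> below by \<open>sqrt (p q)\<close>, whose integral is explicit for Gaussians;
  the price \<open>(p + q) / 8\<close> integrates to a constant.\<close>

lemma two_point_pointwise:
  fixes p q a x :: real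
  assumes "0 \<le> p" "0 \<le> q"
  shows "a\<^sup>2 * sqrt (p * q) \<le> (x - a)\<^sup>2 * p + (x + a)\<^sup>2 * q + a\<^sup>2 * (p + q) / 8"
proof -
  have main: "a\<^sup>2 * sqrt (p * q) \<le> 2 * a\<^sup>2 * min p q + a\<^sup>2 * (p + q) / 8"
  proof -
    \<comment> \<open>The weights 4 and 1/4 in the arithmetic-geometric mean inequality leave a
      price of only 1/8 on the larger density.\<close>
    have "sqrt (p * q) = sqrt (4 * min p q * (max p q / 4))"
      by (simp add: min_def max_def)
    also have "\<dots> \<le> (4 * min p q + max p q / 4) / 2"
      using assms by (intro arith_geo_mean_sqrt) auto
    also have "\<dots> \<le> 2 * min p q + (p + q) / 8"
      using assms by (simp add: min_def max_def)
    finally show ?thesis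
      using mult_left_mono[of _ _ "a\<^sup>2"] by (fastforce simp: algebra_simps)
  qed
  have "2 * a\<^sup>2 * min p q \<le> ((x - a)\<^sup>2 + (x + a)\<^sup>2) * min p q"
    using assms by (intro mult_right_mono) (auto simp: power2_eq_square algebra_simps)
  also have "\<dots> \<le> (x - a)\<^sup>2 * p + (x + a)\<^sup>2 * q"
    by (simp add: distrib_right add_mono mult_left_mono)
  finally show ?thesis using main by simp
qed

text \<open>The share of the squared error that falls on \<open>S\<close>, not divided by
  \<open>n\<close>, so that the shares of disjoint blocks add up.\<close>

definition block_risk ::
  "'i set \<Rightarrow> real \<Rightarrow> 'i set \<Rightarrow> (('i \<Rightarrow> real) \<Rightarrow> ('i \<Rightarrow> real)) \<Rightarrow> ('i \<Rightarrow> real) \<Rightarrow> ennreal" where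
  "block_risk I \<sigma> S est \<theta> =
    (\<integral>\<^sup>+y. ennreal ((\<Sum>i\<in>S. (est y i - \<theta> i)\<^sup>2) * gdens I \<sigma> \<theta> y) \<partial>PiM I (\<lambda>_. lborel))"

lemma block_integrand_measurable:
  assumes "est \<in> PiM I (\<lambda>_. borel) \<rightarrow>\<^sub>M PiM I (\<lambda>_. borel)" "finite I" "S \<subseteq> I"
  shows "(\<lambda>y. ennreal ((\<Sum>i\<in>S. (est y i - \<theta> i)\<^sup>2) * gdens I \<sigma> \<theta> y))
    \<in> borel_measurable (PiM I (\<lambda>_. lborel))"
proof -
  have [measurable_cong]: "sets (PiM I (\<lambda>_. lborel)) = sets (PiM I (\<lambda>_. borel))"
    by (intro sets_PiM_cong) auto
  have [measurable]: "est \<in> PiM I (\<lambda>_. borel) \<rightarrow>\<^sub>M PiM I (\<lambda>_. borel)" by fact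
  have [measurable]: "(\<lambda>y. est y i) \<in> borel_measurable (PiM I (\<lambda>_. borel))" if "i \<in> S" for i
    using that assms(3) by (intro measurable_compose[OF assms(1)] measurable_component_singleton) auto
  have "gdens I \<sigma> \<theta> \<in> borel_measurable (PiM I (\<lambda>_. borel))"
    using gdens_measurable[OF assms(2), of \<sigma> \<theta>] by measurable
  note [measurable] = this
  show ?thesis by measurable
qed

text \<open>No estimator is close on \<open>S\<close> to both a signal and its flip. The affinity is
  \<open>exp (- (1 / 2))\<close>, at least 1/2, which yields \<sigma>^2/2; the price of the
  pointwise bound takes \<sigma>^2/8 for each of the two densities, and \<sigma>^2/4
  remains.\<close>

lemma block_risk_two_point:
  assumes \<sigma>: "\<sigma> > 0" and I: "finite I" and S: "S \<subseteq> I"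
    and est: "est \<in> PiM I (\<lambda>_. borel) \<rightarrow>\<^sub>M PiM I (\<lambda>_. borel)"
    and same: "\<And>i. i \<in> I - S \<Longrightarrow> \<theta>' i = \<theta> i"
    and flip: "\<And>i. i \<in> S \<Longrightarrow> \<theta>' i = - \<theta> i"
    and energy: "(\<Sum>i\<in>S. (\<theta> i)\<^sup>2) = \<sigma>\<^sup>2"
  shows "ennreal (\<sigma>\<^sup>2 / 4) \<le> block_risk I \<sigma> S est \<theta> + block_risk I \<sigma> S est \<theta>'"
proof -
  let ?L = "PiM I (\<lambda>_. lborel) :: ('a \<Rightarrow> real) measure"
  let ?p = "gdens I \<sigma> \<theta>" and ?q = "gdens I \<sigma> \<theta>'"
  let ?r = "gdens I \<sigma> (\<lambda>i. if i \<in> S then 0 else \<theta> i)"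
  let ?R = "\<lambda>\<theta> y. (\<Sum>i\<in>S. (est y i - \<theta> i)\<^sup>2) * gdens I \<sigma> \<theta> y"
  have half: "1 / 2 \<le> exp (- (1 / 2) :: real)"
    using exp_ge_add_one_self[of "- (1 / 2) :: real"] by simp
  have pw: "\<sigma>\<^sup>2 / 2 * ?r y \<le> ?R \<theta> y + ?R \<theta>' y + \<sigma>\<^sup>2 / 8 * (?p y + ?q y)" for y
  proof -
    have "\<sigma>\<^sup>2 * sqrt (?p y * ?q y) = (\<Sum>i\<in>S. (\<theta> i)\<^sup>2 * sqrt (?p y * ?q y))"
      by (simp add: energy[symmetric] sum_distrib_right)
    also have "\<dots> \<le> (\<Sum>i\<in>S. (est y i - \<theta> i)\<^sup>2 * ?p y + (est y i - \<theta>' i)\<^sup>2 * ?q y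
        + (\<theta> i)\<^sup>2 * (?p y + ?q y) / 8)"
      using two_point_pointwise[of "?p y" "?q y" "\<theta> _" "est y _"] flip
      by (intro sum_mono) (simp add: gdens_nonneg)
    also have "\<dots> = ?R \<theta> y + ?R \<theta>' y + \<sigma>\<^sup>2 / 8 * (?p y + ?q y)"
      by (simp add: sum.distrib sum_distrib_right[symmetric] sum_divide_distrib[symmetric] energy)
    finally have "\<sigma>\<^sup>2 * (exp (- (1 / 2)) * ?r y) \<le> ?R \<theta> y + ?R \<theta>' y + \<sigma>\<^sup>2 / 8 * (?p y + ?q y)"
      using sqrt_gdens_mult[OF \<sigma> I S, of \<theta>' \<theta> y] same flip energy \<sigma> by simp
    moreover have "\<sigma>\<^sup>2 * (1 / 2 * ?r y) \<le> \<sigma>\<^sup>2 * (exp (- (1 / 2)) * ?r y)"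
      using half by (intro mult_left_mono mult_right_mono) (auto simp: gdens_nonneg)
    ultimately show ?thesis by simp
  qed
  have Rnn: "0 \<le> ?R \<theta> y" for \<theta> y
    by (simp add: sum_nonneg gdens_nonneg)
  note meas [measurable] = gdens_measurable[OF I] block_integrand_measurable[OF est I S]
  have "ennreal (\<sigma>\<^sup>2 / 2) = (\<integral>\<^sup>+y. ennreal (\<sigma>\<^sup>2 / 2 * ?r y) \<partial>?L)"
    using gdens_nonneg[of I \<sigma>]
    by (subst ennreal_mult) (simp_all add: nn_integral_cmult nn_integral_gdens[OF \<sigma> I])
  also have "\<dots> \<le> (\<integral>\<^sup>+y. (ennreal (?R \<theta> y) + ennreal (?R \<theta>' y))
      + ennreal (\<sigma>\<^sup>2 / 8) * (ennreal (?p y) + ennreal (?q y)) \<partial>?L)"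
    using pw
    by (intro nn_integral_mono)
      (simp add: ennreal_plus[symmetric] ennreal_mult[symmetric] Rnn gdens_nonneg ennreal_leI
        del: ennreal_plus)
  also have "\<dots> = block_risk I \<sigma> S est \<theta> + block_risk I \<sigma> S est \<theta>' + ennreal (\<sigma>\<^sup>2 / 8) * (1 + 1)"
    by (simp add: nn_integral_add nn_integral_cmult nn_integral_gdens[OF \<sigma> I] block_risk_def)
  also have "ennreal (\<sigma>\<^sup>2 / 8) * (1 + 1) = ennreal (\<sigma>\<^sup>2 / 4)"
    using ennreal_mult[of "\<sigma>\<^sup>2 / 8" 2] by simp
  \<comment> \<open>The price is finite and hence cancels, even if a block risk is infinite.\<close>
  finally have "ennreal (\<sigma>\<^sup>2 / 4) + ennreal (\<sigma>\<^sup>2 / 4)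
      \<le> block_risk I \<sigma> S est \<theta> + block_risk I \<sigma> S est \<theta>' + ennreal (\<sigma>\<^sup>2 / 4)"
    by (simp add: ennreal_plus[symmetric] del: ennreal_plus)
  then show ?thesis
    by (simp add: add.commute ennreal_add_left_cancel_le)
qed

subsection \<open>Assouad's bound\<close>

text \<open>Toggling \<open>j\<close> is an involution of \<open>Pow J\<close>. It pairs each sign
  pattern with the one that differs at block \<open>j\<close> only.\<close>

lemma sum_Pow_toggle:
  fixes f :: "'j set \<Rightarrow> 'b :: comm_monoid_add"
  assumes "j \<in> J"
  shows "(\<Sum>A\<in>Pow J. f (sym_diff A {j})) = (\<Sum>A\<in>Pow J. f A)"
  by (rule sum.reindex_bij_witness[of _ "\<lambda>A. sym_diff A {j}" "\<lambda>A. sym_diff A {j}"])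
    (use assms in auto)

text \<open>\<open>A\<close> collects the labels that carry a plus sign. The restriction to
  \<open>{1..n}\<close> makes the signal extensional, as membership in \<open>BV\<close>
  demands.\<close>

definition sign_signal :: "nat \<Rightarrow> (nat \<Rightarrow> 'j) \<Rightarrow> (nat \<Rightarrow> real) \<Rightarrow> 'j set \<Rightarrow> nat \<Rightarrow> real" where
  "sign_signal n c \<delta> A = (\<lambda>i\<in>{1..n}. if c i \<in> A then \<delta> i else - \<delta> i)"

text \<open>The blocks are disjoint, so their errors add up to at most the full squared error; the
  factor \<open>n\<close> undoes the normalisation.\<close>

lemma sum_block_risk_le:
  assumes \<sigma>: "\<sigma> > 0" and est: "est \<in> estimators n" and n: "n \<ge> 1" and J: "finite J"
  shows "(\<Sum>j\<in>J. block_risk {1..n} \<sigma> {i\<in>{1..n}. c i = j} est \<theta>) \<le> ennreal (real n) * risk n \<sigma> est \<theta>"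
proof -
  let ?L = "PiM {1..n} (\<lambda>_. lborel) :: (nat \<Rightarrow> real) measure"
  have est': "est \<in> PiM {1..n} (\<lambda>_. borel) \<rightarrow>\<^sub>M PiM {1..n} (\<lambda>_. borel)"
    using est by (simp add: estimators_def)
  note meas = block_integrand_measurable[OF est' finite_atLeastAtMost]
  have "(\<Sum>j\<in>J. block_risk {1..n} \<sigma> {i\<in>{1..n}. c i = j} est \<theta>)
      = (\<integral>\<^sup>+y. (\<Sum>j\<in>J. ennreal ((\<Sum>i\<in>{i\<in>{1..n}. c i = j}. (est y i - \<theta> i)\<^sup>2) * gdens {1..n} \<sigma> \<theta> y)) \<partial>?L)"
    unfolding block_risk_def by (intro nn_integral_sum[symmetric] meas) auto
  also have "\<dots> \<le> (\<integral>\<^sup>+y. ennreal ((\<Sum>i=1..n. (est y i - \<theta> i)\<^sup>2) * gdens {1..n} \<sigma> \<theta> y) \<partial>?L)"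
  proof (intro nn_integral_mono)
    fix y
    have "(\<Sum>j\<in>J. \<Sum>i\<in>{i\<in>{1..n}. c i = j}. (est y i - \<theta> i)\<^sup>2)
        = (\<Sum>i\<in>(\<Union>j\<in>J. {i\<in>{1..n}. c i = j}). (est y i - \<theta> i)\<^sup>2)"
      by (rule sum.UNION_disjoint[symmetric]) (use J in auto)
    also have "\<dots> \<le> (\<Sum>i=1..n. (est y i - \<theta> i)\<^sup>2)"
      by (intro sum_mono2) auto
    finally have "(\<Sum>j\<in>J. \<Sum>i\<in>{i\<in>{1..n}. c i = j}. (est y i - \<theta> i)\<^sup>2) * gdens {1..n} \<sigma> \<theta> y
        \<le> (\<Sum>i=1..n. (est y i - \<theta> i)\<^sup>2) * gdens {1..n} \<sigma> \<theta> y"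
      by (intro mult_right_mono gdens_nonneg)
    then show "(\<Sum>j\<in>J. ennreal ((\<Sum>i\<in>{i\<in>{1..n}. c i = j}. (est y i - \<theta> i)\<^sup>2) * gdens {1..n} \<sigma> \<theta> y))
        \<le> ennreal ((\<Sum>i=1..n. (est y i - \<theta> i)\<^sup>2) * gdens {1..n} \<sigma> \<theta> y)"
      by (subst sum_ennreal)
        (auto simp: sum_distrib_right[symmetric] sum_nonneg gdens_nonneg intro!: ennreal_leI)
  qed
  also have "\<dots> = (\<integral>\<^sup>+y. ennreal (real n) *
      ennreal (normsq_n n (\<lambda>i. est y i - \<theta> i) * gdens {1..n} \<sigma> \<theta> y) \<partial>?L)"
    using n by (intro nn_integral_cong)
      (simp add: ennreal_mult[symmetric] normsq_n_def sum_nonneg gdens_nonneg)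
  also have "\<dots> = ennreal (real n) * risk n \<sigma> est \<theta>"
    unfolding risk_eq_gdens[OF \<sigma> est] normsq_n_def
  proof (intro nn_integral_cmult)
    show "(\<lambda>y. ennreal ((\<Sum>i = 1..n. (est y i - \<theta> i)\<^sup>2) / real n * gdens {1..n} \<sigma> \<theta> y))
        \<in> borel_measurable ?L"
    proof -
      have "(\<lambda>y. ennreal (1 / real n) * ennreal ((\<Sum>i\<in>{1..n}. (est y i - \<theta> i)\<^sup>2) * gdens {1..n} \<sigma> \<theta> y))
          \<in> borel_measurable ?L"
        using meas[OF order_refl] by (intro borel_measurable_times_ennreal borel_measurable_const)
      then show ?thesis
        by (simp add: ennreal_mult[symmetric] sum_nonneg gdens_nonneg)
    qed
  qed
  finally show ?thesis .
qed

text \<open>The worst risk is at least the average over all sign patterns. For each block the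
  patterns pair up with their flips, each pair costing \<sigma>^2/4 in total, so a block costs at
  least \<sigma>^2/8 on average; summing over \<open>J\<close> and dividing by \<open>n\<close>
  gives the bound.\<close>

lemma assouad_gauss:
  fixes c :: "nat \<Rightarrow> 'j"
  assumes \<sigma>: "\<sigma> > 0" and n: "n \<ge> 1" and J: "finite J"
    and energy: "\<And>j. j \<in> J \<Longrightarrow> (\<Sum>i\<in>{i\<in>{1..n}. c i = j}. (\<delta> i)\<^sup>2) = \<sigma>\<^sup>2"
    and mem: "\<And>A. A \<subseteq> J \<Longrightarrow> sign_signal n c \<delta> A \<in> \<Theta>"
  shows "minimax_risk n \<sigma> \<Theta> \<ge> ennreal (real (card J) * \<sigma>\<^sup>2 / (8 * real n))"
  unfolding minimax_risk_def
proof (rule INF_greatest)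
  fix est assume est: "est \<in> estimators n"
  have est': "est \<in> PiM {1..n} (\<lambda>_. borel) \<rightarrow>\<^sub>M PiM {1..n} (\<lambda>_. borel)"
    using est by (simp add: estimators_def)
  let ?S = "SUP \<theta>\<in>\<Theta>. risk n \<sigma> est \<theta>"
  let ?R = "\<lambda>j A. block_risk {1..n} \<sigma> {i\<in>{1..n}. c i = j} est (sign_signal n c \<delta> A)"
  have pair: "ennreal (\<sigma>\<^sup>2 / 4) \<le> ?R j A + ?R j (sym_diff A {j})" if "j \<in> J" for j A
  proof (rule block_risk_two_point[OF \<sigma> _ _ est'])
    show "(\<Sum>i\<in>{i\<in>{1..n}. c i = j}. (sign_signal n c \<delta> A i)\<^sup>2) = \<sigma>\<^sup>2"
      unfolding energy[OF that, symmetric] by (intro sum.cong) (auto simp: sign_signal_def)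
  qed (auto simp: sign_signal_def)
  have "(\<Sum>j\<in>J. \<Sum>A\<in>Pow J. \<sigma>\<^sup>2 / 4) = 2 ^ card J * (real (card J) * (\<sigma>\<^sup>2 / 4))"
    using J by (simp add: card_Pow)
  then have "ennreal (2 ^ card J * (real (card J) * (\<sigma>\<^sup>2 / 4)))
      = (\<Sum>j\<in>J. \<Sum>A\<in>Pow J. ennreal (\<sigma>\<^sup>2 / 4))"
    by (simp add: sum_ennreal sum_nonneg del: sum_constant)
  also have "\<dots> \<le> (\<Sum>j\<in>J. \<Sum>A\<in>Pow J. ?R j A + ?R j (sym_diff A {j}))"
    using pair by (intro sum_mono) auto
  also have "\<dots> = (\<Sum>j\<in>J. (\<Sum>A\<in>Pow J. ?R j A) + (\<Sum>A\<in>Pow J. ?R j A))"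
  proof (intro sum.cong refl)
    fix j assume "j \<in> J"
    then show "(\<Sum>A\<in>Pow J. ?R j A + ?R j (sym_diff A {j}))
        = (\<Sum>A\<in>Pow J. ?R j A) + (\<Sum>A\<in>Pow J. ?R j A)"
      by (simp only: sum.distrib sum_Pow_toggle[of j J "?R j"])
  qed
  also have "\<dots> = 2 * (\<Sum>A\<in>Pow J. \<Sum>j\<in>J. ?R j A)"
    by (subst sum.swap) (simp add: sum.distrib mult_2 sum_distrib_left)
  also have "\<dots> \<le> 2 * (\<Sum>A\<in>Pow J. ennreal (real n) * ?S)"
  proof (intro mult_left_mono sum_mono)
    fix A assume "A \<in> Pow J"
    then have "sign_signal n c \<delta> A \<in> \<Theta>" using mem by auto
    then have "risk n \<sigma> est (sign_signal n c \<delta> A) \<le> ?S" by (rule SUP_upper)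
    note order_trans[OF sum_block_risk_le[OF \<sigma> est n J] mult_left_mono[OF this]]
    then show "(\<Sum>j\<in>J. ?R j A) \<le> ennreal (real n) * ?S"
      by simp
  qed simp
  also have "\<dots> = ennreal (2 ^ card J * (2 * real n)) * ?S"
  proof -
    have "ennreal (2 ^ card J * (2 * real n)) = 2 ^ card J * (2 * ennreal (real n))"
      by (simp add: ennreal_mult flip: ennreal_power)
    then show ?thesis
      using J by (simp only: sum_constant card_Pow of_nat_power of_nat_numeral mult_ac)
  qed
  finally have main: "ennreal (2 ^ card J * (real (card J) * (\<sigma>\<^sup>2 / 4)))
      \<le> ennreal (2 ^ card J * (2 * real n)) * ?S" .
  show "ennreal (real (card J) * \<sigma>\<^sup>2 / (8 * real n)) \<le> ?S"
  proof (cases ?S)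
    case (real x)
    with main have "2 ^ card J * (real (card J) * (\<sigma>\<^sup>2 / 4)) \<le> 2 ^ card J * (2 * real n) * x"
      by (simp add: ennreal_mult[symmetric])
    then have "real (card J) * \<sigma>\<^sup>2 / (8 * real n) \<le> x"
      using n by (simp add: field_simps)
    with real show ?thesis by (simp add: ennreal_leI)
  next
    case top
    show ?thesis unfolding top by (rule top_greatest)
  qed
qed

text \<open>Height and sign depend on the label only, so the signal jumps only across cut edges, and
  by at most \<open>2 * b\<close> there.\<close>

lemma graph_tv_sign_signal_le:
  assumes E: "finite E" "\<And>e. e \<in> E \<Longrightarrow> e \<subseteq> {1..n} \<and> e \<noteq> {}"
    and cut: "card {e \<in> E. \<not> (\<exists>k. \<forall>x\<in>e. c x = k)} \<le> m"
    and \<delta>: "\<And>i. \<bar>\<delta> (c i)\<bar> \<le> b"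
  shows "graph_tv E (sign_signal n c (\<lambda>i. \<delta> (c i)) A) \<le> real m * (2 * b)"
proof -
  let ?\<theta> = "sign_signal n c (\<lambda>i. \<delta> (c i)) A"
  let ?K = "{e \<in> E. \<not> (\<exists>k. \<forall>x\<in>e. c x = k)}"
  have b: "0 \<le> b" using \<delta>[of 0] by linarith
  have bound: "\<bar>?\<theta> (Max e) - ?\<theta> (Min e)\<bar> \<le> (if e \<in> ?K then 2 * b else 0)" if e: "e \<in> E" for e
  proof -
    have "finite e" "e \<noteq> {}" "e \<subseteq> {1..n}"
      using E(2)[OF e] finite_subset by blast+
    then have in_e: "Max e \<in> e" "Min e \<in> e" by simp_all
    then have "Max e \<in> {1..n}" "Min e \<in> {1..n}" using \<open>e \<subseteq> {1..n}\<close> by blast+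
    then have \<theta>: "?\<theta> (Max e) = (if c (Max e) \<in> A then \<delta> (c (Max e)) else - \<delta> (c (Max e)))"
      "?\<theta> (Min e) = (if c (Min e) \<in> A then \<delta> (c (Min e)) else - \<delta> (c (Min e)))"
      by (simp_all add: sign_signal_def)
    show ?thesis
    proof (cases "e \<in> ?K")
      case True
      with \<theta> \<delta>[of "Max e"] \<delta>[of "Min e"] show ?thesis by (simp split: if_splits)
    next
      case False
      with e in_e have "c (Max e) = c (Min e)" by force
      with \<theta> False b show ?thesis by simp
    qed
  qed
  have "graph_tv E ?\<theta> \<le> (\<Sum>e\<in>E. if e \<in> ?K then 2 * b else 0)"
    unfolding graph_tv_def using bound by (intro sum_mono)
  also have "\<dots> = real (card ?K) * (2 * b)"
    using E(1) by (subst sum.If_cases) (auto simp: Int_def intro!: arg_cong[where f = card])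
  also have "\<dots> \<le> real m * (2 * b)"
    using cut b by (intro mult_right_mono) auto
  finally show ?thesis .
qed

lemma minimax_risk_BV_partition:
  assumes \<sigma>: "\<sigma> > 0" and n: "n \<ge> 1" and J: "finite J" and s: "s \<ge> 1"
    and E: "finite E" "\<And>e. e \<in> E \<Longrightarrow> e \<subseteq> {1..n} \<and> e \<noteq> {}"
    and cut: "card {e \<in> E. \<not> (\<exists>k. \<forall>x\<in>e. c x = k)} \<le> m"
    and size: "\<And>j. j \<in> J \<Longrightarrow> s \<le> card {i\<in>{1..n}. c i = j}"
    and t: "real m * (2 * (\<sigma> / sqrt (real s))) \<le> t"
  shows "minimax_risk n \<sigma> (BV {1..n} E t) \<ge> ennreal (real (card J) * \<sigma>\<^sup>2 / (8 * real n))"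
proof -
  \<comment> \<open>This height gives each block the energy \<sigma>^2. It vanishes on the leftover,
    so cut edges that touch the leftover obey the same jump bound.\<close>
  define \<delta> where "\<delta> j = (if j \<in> J then \<sigma> / sqrt (real (card {i\<in>{1..n}. c i = j})) else 0)" for j
  have bound: "\<bar>\<delta> j\<bar> \<le> \<sigma> / sqrt (real s)" for j
  proof (cases "j \<in> J")
    case True
    then have "0 < real s" "real s \<le> real (card {i\<in>{1..n}. c i = j})"
      using size s by auto
    then have "\<sigma> / sqrt (real (card {i\<in>{1..n}. c i = j})) \<le> \<sigma> / sqrt (real s)"
      using \<sigma> by (intro divide_left_mono) auto
    with True \<sigma> show ?thesis by (simp add: \<delta>_def)
  qed (use \<sigma> in \<open>simp add: \<delta>_def\<close>)
  show ?thesis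
  proof (rule assouad_gauss[OF \<sigma> n J])
    fix j assume j: "j \<in> J"
    then have pos: "card {i\<in>{1..n}. c i = j} > 0" using size s by fastforce
    have "(\<Sum>i\<in>{i\<in>{1..n}. c i = j}. (\<delta> (c i))\<^sup>2) = (\<Sum>i\<in>{i\<in>{1..n}. c i = j}. (\<delta> j)\<^sup>2)"
      by (intro sum.cong) auto
    also have "\<dots> = \<sigma>\<^sup>2"
      using j pos by (auto simp: \<delta>_def power_divide card_gt_0_iff)
    finally show "(\<Sum>i\<in>{i\<in>{1..n}. c i = j}. (\<delta> (c i))\<^sup>2) = \<sigma>\<^sup>2" .
  next
    fix A
    have "graph_tv E (sign_signal n c (\<lambda>i. \<delta> (c i)) A) \<le> t"
      using graph_tv_sign_signal_le[OF E cut bound] t by (rule order_trans)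
    then show "sign_signal n c (\<lambda>i. \<delta> (c i)) A \<in> BV {1..n} E t"
      by (simp add: BV_def sign_signal_def)
  qed
qed

subsection \<open>The lower bound on trees\<close>

lemma minimax_risk_tree_scale:
  assumes \<sigma>: "\<sigma> > 0" and tree: "is_tree {1..n} E" and n: "n \<ge> 1" and s: "s \<ge> 1"
    and d: "max_degree {1..n} E \<ge> 1"
    and t: "2 * \<sigma> * real n \<le> t * (real s * sqrt (real s))" "t > 0"
  shows "minimax_risk n \<sigma> (BV {1..n} E t)
    \<ge> ennreal (\<sigma>\<^sup>2 / (32 * (real (max_degree {1..n} E) * real s)))"
proof -
  let ?d = "max_degree {1..n} E"
  have E: "finite E" "\<And>e. e \<in> E \<Longrightarrow> e \<subseteq> {1..n} \<and> e \<noteq> {}"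
    using grows_finite[OF tree_grows[OF tree]] tree
    by (auto simp: is_tree_def simple_graph_def)
  have ds: "real s \<le> real ?d * real s"
    using d by (simp flip: of_nat_mult)
  show ?thesis
  proof (cases "n < 2 * s")
    case True
    \<comment> \<open>Here the whole vertex set serves as a single block. Nothing is cut and the
      signal has total variation 0, and \<open>n < 2 * s\<close> makes the resulting bound large
      enough.\<close>
    have "minimax_risk n \<sigma> (BV {1..n} E t) \<ge> ennreal (real (card {0::nat}) * \<sigma>\<^sup>2 / (8 * real n))"
    proof (rule minimax_risk_BV_partition[OF \<sigma> n _ order_refl E, where c = "\<lambda>_. 0" and m = 0])
      show "1 \<le> card {i \<in> {1..n}. 0 = j}" if "j \<in> {0}" for j :: nat
      proof -
        have "{i \<in> {1..n}. 0 = j} = {1..n}" using that by auto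
        then show ?thesis using n by simp
      qed
    qed (use t in simp_all)
    moreover have "\<sigma>\<^sup>2 / (32 * (real ?d * real s)) \<le> real (card {0::nat}) * \<sigma>\<^sup>2 / (8 * real n)"
    proof -
      have "8 * real n \<le> 32 * (real ?d * real s)" using True ds by linarith
      moreover have "0 < 8 * real n" using n by simp
      ultimately show ?thesis by (simp add: frac_le)
    qed
    ultimately show ?thesis by (meson ennreal_leI order_trans)
  next
    case False
    obtain c :: "nat \<Rightarrow> nat" and J where J: "finite J"
      and size: "\<forall>j\<in>J. s \<le> card {x\<in>{1..n}. c x = j}"
      and total: "card {1..n} \<le> card J * (1 + ?d * s) + s"
      and cut: "card {e \<in> E. \<not> (\<exists>k. \<forall>x\<in>e. c x = k)} \<le> card J"
      using tree_partition[OF tree s] by blast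
    have "real (card J) * real s \<le> real n"
      using card_mult_le_of_blocks[OF _ J, of "{1..n}" s c] size by (simp flip: of_nat_mult)
    \<comment> \<open>The number of blocks is at most \<open>n / s\<close>, which turns the
      assumption on \<open>s\<close> into the total variation budget for the sign signals.\<close>
    then have "2 * \<sigma> * (real (card J) * real s) \<le> t * (real s * sqrt (real s))"
      using t(1) \<sigma> by (intro order_trans[OF mult_left_mono t(1)]) auto
    then have "real (card J) * (2 * (\<sigma> / sqrt (real s))) \<le> t"
      using s by (simp add: field_simps)
    then have "minimax_risk n \<sigma> (BV {1..n} E t) \<ge> ennreal (real (card J) * \<sigma>\<^sup>2 / (8 * real n))"
      using minimax_risk_BV_partition[OF \<sigma> n J s E cut] size by simp
    moreover have "\<sigma>\<^sup>2 / (32 * (real ?d * real s)) \<le> real (card J) * \<sigma>\<^sup>2 / (8 * real n)"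
    proof -
      \<comment> \<open>As \<open>?d * s\<close> is at least 1, the block bound is at most
        \<open>2 * (?d * s)\<close>. The leftover \<open>s\<close> is at most half of
        \<open>n\<close> and is absorbed by another factor 2; together with the 8 of the Assouad
        bound this makes 32.\<close>
      have "1 + ?d * s \<le> 2 * (?d * s)" using d s by simp
      then have "card J * (1 + ?d * s) \<le> card J * (2 * (?d * s))" by (rule mult_le_mono2)
      moreover have "n \<le> card J * (1 + ?d * s) + s" using total by simp
      ultimately have "n \<le> 4 * (card J * (?d * s))" using False by linarith
      then have "real n \<le> real (4 * (card J * (?d * s)))" by (rule of_nat_mono)
      then have "\<sigma>\<^sup>2 * real n \<le> \<sigma>\<^sup>2 * (4 * (real (card J) * (real ?d * real s)))"
        by (intro mult_left_mono) auto
      then show ?thesis using n s d by (simp add: field_simps)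
    qed
    ultimately show ?thesis by (meson ennreal_leI order_trans)
  qed
qed

text \<open>\<sigma> is fixed ahead of \<open>N\<close> and \<open>C\<close>, which are chosen as
  1/(2\<sigma>) and \<sigma>^2/128. Rescaling the data by \<sigma> reduces these to 1/2 and 1/128 at
  unit noise.\<close>

theorem theorem4:
  fixes \<sigma> :: real
  assumes "\<sigma> > 0"
  shows "\<exists>N C :: real. N > 0 \<and> C > 0 \<and>
    (\<forall>(n :: nat) (E :: nat set set) (t :: real).
       is_tree {1..n} E \<and> t > 0 \<and> real n / (t * real (max_degree {1..n} E)) > N \<longrightarrow>
       minimax_risk n \<sigma> (BV {1..n} E t)
         \<ge> ennreal (C * (t / (\<sigma> * (real (max_degree {1..n} E))\<^sup>2 * real n)) powr (2 / 3)))"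
proof (rule exI[of _ "1 / (2 * \<sigma>)"], rule exI[of _ "\<sigma>\<^sup>2 / 128"], intro conjI allI impI)
  fix n :: nat and E :: "nat set set" and t :: real
  let ?d = "max_degree {1..n} E"
  assume asm: "is_tree {1..n} E \<and> t > 0 \<and> real n / (t * real ?d) > 1 / (2 * \<sigma>)"
  then have tree: "is_tree {1..n} E" and t: "t > 0"
    and N: "real n / (t * real ?d) > 1 / (2 * \<sigma>)" by auto
  \<comment> \<open>A quotient with denominator 0 is 0, so positivity excludes the one-vertex tree,
    whose maximum degree is 0.\<close>
  have "real n / (t * real ?d) > 0"
    using N assms by (meson divide_pos_pos less_trans mult_pos_pos zero_less_numeral zero_less_one)
  then have nd: "n \<ge> 1" "?d \<ge> 1"
    using t by (auto simp: zero_less_divide_iff zero_less_mult_iff)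
  \<comment> \<open>The real solution of \<open>x * sqrt x = 2 * \<sigma> * real n / t\<close>, the
    least block size that meets the total variation budget. The threshold \<open>N\<close> ensures
    \<open>1 \<le> x\<close>, so rounding up to \<open>s\<close> at most doubles it.\<close>
  define x where "x = (2 * \<sigma> * real n / t) powr (2 / 3)"
  have "t * real ?d < 2 * \<sigma> * real n"
    using N assms t nd by (simp add: field_simps)
  moreover have "t \<le> t * real ?d" using t nd by simp
  ultimately have "t < 2 * \<sigma> * real n" by linarith
  then have base: "1 \<le> 2 * \<sigma> * real n / t" using t by simp
  then have x: "1 \<le> x" unfolding x_def by (intro ge_one_powr_ge_zero) auto
  define s where "s = nat \<lceil>x\<rceil>"
  have s: "x \<le> real s" "real s \<le> 2 * x" "s \<ge> 1"
    using x unfolding s_def by linarith+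
  have "2 * \<sigma> * real n / t = x * sqrt x"
  proof -
    have "x * sqrt x = x powr 1 * x powr (1 / 2)"
      using x by (simp add: powr_half_sqrt)
    also have "\<dots> = x powr (3 / 2)"
      by (simp only: powr_add[symmetric]) simp
    also have "\<dots> = 2 * \<sigma> * real n / t"
      using base assms t unfolding x_def by (simp add: powr_powr)
    finally show ?thesis by simp
  qed
  also have "\<dots> \<le> real s * sqrt (real s)"
    using s x by (intro mult_mono) auto
  finally have "2 * \<sigma> * real n \<le> t * (real s * sqrt (real s))"
    using t by (simp add: field_simps)
  then have "ennreal (\<sigma>\<^sup>2 / (32 * (real ?d * real s))) \<le> minimax_risk n \<sigma> (BV {1..n} E t)"
    by (rule minimax_risk_tree_scale[OF assms tree nd(1) s(3) nd(2) _ t])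
  moreover have "\<sigma>\<^sup>2 / 128 * (t / (\<sigma> * (real ?d)\<^sup>2 * real n)) powr (2 / 3)
      \<le> \<sigma>\<^sup>2 / (32 * (real ?d * real s))"
  proof -
    \<comment> \<open>Separates the factor that becomes \<open>1 / x\<close>, leaving a power of the
      degree alone.\<close>
    have "t / (\<sigma> * (real ?d)\<^sup>2 * real n) = (2 / (real ?d)\<^sup>2) / (2 * \<sigma> * real n / t)"
      using t assms nd by (simp add: field_simps)
    then have "(t / (\<sigma> * (real ?d)\<^sup>2 * real n)) powr (2 / 3)
        = ((2 / (real ?d)\<^sup>2) / (2 * \<sigma> * real n / t)) powr (2 / 3)"
      by (simp only:)
    also have "\<dots> = (2 / (real ?d)\<^sup>2) powr (2 / 3) / x"
      unfolding x_def by (rule powr_divide)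
    finally have eq: "(t / (\<sigma> * (real ?d)\<^sup>2 * real n)) powr (2 / 3)
        = (2 / (real ?d)\<^sup>2) powr (2 / 3) / x" .
    \<comment> \<open>The degree is at least 1, so its power 4/3 may be lowered to 1, the order in
      which it enters the bound at scale \<open>s\<close>.\<close>
    have "(2 / (real ?d)\<^sup>2) powr (2 / 3) \<le> 2 / real ?d"
    proof -
      have "(2 / (real ?d)\<^sup>2) powr (2 / 3) = 2 powr (2 / 3) / real ?d powr (4 / 3)"
        using nd by (simp add: powr_divide powr_powr flip: powr_numeral)
      also have "\<dots> \<le> 2 powr 1 / real ?d powr 1"
        using nd by (intro frac_le powr_mono) auto
      finally show ?thesis using nd by simp
    qed
    then have "(t / (\<sigma> * (real ?d)\<^sup>2 * real n)) powr (2 / 3) \<le> 2 / real ?d / x"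
      unfolding eq using x by (intro divide_right_mono) auto
    also have "\<dots> = 4 / (real ?d * (2 * x))"
      by simp
    also have "\<dots> \<le> 4 / (real ?d * real s)"
      using s nd x by (intro divide_left_mono mult_left_mono) auto
    finally have "\<sigma>\<^sup>2 / 128 * (t / (\<sigma> * (real ?d)\<^sup>2 * real n)) powr (2 / 3)
        \<le> \<sigma>\<^sup>2 / 128 * (4 / (real ?d * real s))"
      by (intro mult_left_mono) auto
    also have "\<dots> = \<sigma>\<^sup>2 / (32 * (real ?d * real s))" by simp
    finally show ?thesis .
  qed
  ultimately show "minimax_risk n \<sigma> (BV {1..n} E t)
      \<ge> ennreal (\<sigma>\<^sup>2 / 128 * (t / (\<sigma> * (real ?d)\<^sup>2 * real n)) powr (2 / 3))"
    by (meson ennreal_leI order_trans)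
qed (use assms in auto)

end
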